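(* Let $\kappa$ be a field and $D_\infty=\langle a,b\mid b^2=1,\ ba=a^{-1}b\rangle$ the infinite dihedral group. The lateral factor sets of $D_\infty$ (with pointwise multiplication) are isomorphic as a semigroup to $$\big\{\omega:\mathbb{Z}^+\times\mathbb{Z}^+\ \sqcup\ \mathbb{Z}^+\times\mathbb{Z}\to\{0,1\}\big\}$$ (with pointwise multiplication).
   Context: For a group $G$ and $x,y\in G$ let $C_{(x,y)}:=\{(x,y),(y^{-1}x^{-1},x),(y,y^{-1}x^{-1}),(y^{-1},x^{-1}),(x^{-1},xy),(xy,y^{-1})\}$. A lateral factor set of $G$ is a function of the form $\sigma_W:G\times G\to\{0,1\}\subseteq\kappa$, where $W\subseteq G\times G$ satisfies $C_{(z,z^{-1})}\cap W=\varnothing$ for all $z\in G$, and $\sigma_W(x,y)=0$ if $C_{(x,y)}\cap W\neq\varnothing$, $\sigma_W(x,y)=1$ otherwise. $\mathbb{Z}^+$ is the set of positive integers, and $\sqcup$ denotes disjoint union. *)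

theory Defs
  imports "HOL-Algebra.Algebra"
begin

section \<open>Groups given by generators and relations\<close>

text \<open>
  A word over the generators \<^typ>\<open>'g\<close> is a list of signed letters: \<^term>\<open>(x, True)\<close> stands for
  the generator \<open>x\<close> and \<^term>\<open>(x, False)\<close> for its formal inverse.  A relation \<open>u = v\<close> is a pair of
  words \<open>(u, v)\<close>.  All elements of the type \<^typ>\<open>'g\<close> are generators.
\<close>

type_synonym 'g word = "('g \<times> bool) list"

inductive word_eq :: "('g word \<times> 'g word) set \<Rightarrow> 'g word \<Rightarrow> 'g word \<Rightarrow> bool"
  for R :: "('g word \<times> 'g word) set" where
  refl: "word_eq R u u"
| sym: "word_eq R u v \<Longrightarrow> word_eq R v u"
| trans: "word_eq R u v \<Longrightarrow> word_eq R v w \<Longrightarrow> word_eq R u w"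
| append: "word_eq R u u' \<Longrightarrow> word_eq R v v' \<Longrightarrow> word_eq R (u @ v) (u' @ v')"
| cancel: "word_eq R [(x, e), (x, \<not> e)] []"
| relation: "(u, v) \<in> R \<Longrightarrow> word_eq R u v"

definition word_class :: "('g word \<times> 'g word) set \<Rightarrow> 'g word \<Rightarrow> 'g word set" where
  "word_class R u = {v. word_eq R u v}"

definition presented_group :: "('g word \<times> 'g word) set \<Rightarrow> 'g word set monoid" where
  "presented_group R =
     \<lparr>carrier = range (word_class R),
      monoid.mult = (\<lambda>A B. {w. \<exists>u\<in>A. \<exists>v\<in>B. word_eq R (u @ v) w}),
      one = word_class R []\<rparr>"

lemma word_class_eq_iff: "word_class R u = word_class R v \<longleftrightarrow> word_eq R u v"
  unfolding word_class_def by (blast intro: word_eq.intros)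

lemma presented_group_mult:
  "word_class R u \<otimes>\<^bsub>presented_group R\<^esub> word_class R v = word_class R (u @ v)"
  unfolding presented_group_def word_class_def
  by (auto intro: word_eq.trans word_eq.append word_eq.refl)

lemma word_eq_left_inverse: "\<exists>v. word_eq R (v @ u) []"
proof (induction u)
  case Nil
  show ?case by (metis append_Nil word_eq.refl)
next
  case (Cons l u)
  then obtain v where v: "word_eq R (v @ u) []" by blast
  obtain x e where l: "l = (x, e)" by (cases l)
  have "word_eq R (v @ [(x, \<not> e), (x, \<not> \<not> e)] @ u) (v @ [] @ u)"
    by (intro word_eq.append word_eq.refl word_eq.cancel)
  then have "word_eq R ((v @ [(x, \<not> e)]) @ l # u) (v @ u)" by (simp add: l)
  then show ?case using v word_eq.trans by blast
qed

lemma group_presented_group: "group (presented_group R)"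
proof (rule groupI)
  have carrier: "A \<in> carrier (presented_group R) \<longleftrightarrow> (\<exists>u. A = word_class R u)" for A
    by (auto simp: presented_group_def)
  have one: "\<one>\<^bsub>presented_group R\<^esub> = word_class R []"
    by (simp add: presented_group_def)
  show "\<one>\<^bsub>presented_group R\<^esub> \<in> carrier (presented_group R)"
    using one carrier by blast
  fix A assume "A \<in> carrier (presented_group R)"
  then obtain u where u: "A = word_class R u" using carrier by blast
  show "\<one>\<^bsub>presented_group R\<^esub> \<otimes>\<^bsub>presented_group R\<^esub> A = A"
    by (simp add: u one presented_group_mult)
  show "\<exists>B\<in>carrier (presented_group R). B \<otimes>\<^bsub>presented_group R\<^esub> A = \<one>\<^bsub>presented_group R\<^esub>"
    using word_eq_left_inverse[of R u]
    by (metis carrier one presented_group_mult u word_class_eq_iff)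
  fix B assume "B \<in> carrier (presented_group R)"
  then obtain v where v: "B = word_class R v" using carrier by blast
  show "A \<otimes>\<^bsub>presented_group R\<^esub> B \<in> carrier (presented_group R)"
    using carrier by (auto simp: u v presented_group_mult)
  fix C assume "C \<in> carrier (presented_group R)"
  then obtain w where w: "C = word_class R w" using carrier by blast
  show "A \<otimes>\<^bsub>presented_group R\<^esub> B \<otimes>\<^bsub>presented_group R\<^esub> C =
        A \<otimes>\<^bsub>presented_group R\<^esub> (B \<otimes>\<^bsub>presented_group R\<^esub> C)"
    by (simp add: u v w presented_group_mult)
qed

section \<open>The infinite dihedral group\<close>

datatype dihedral_gen = Gen_a | Gen_b

text \<open>The relations \<open>b\<^sup>2 = 1\<close> and \<open>b a = a\<^sup>-\<^sup>1 b\<close>.\<close>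

definition dihedral_relations :: "(dihedral_gen word \<times> dihedral_gen word) set" where
  "dihedral_relations =
     {([(Gen_b, True), (Gen_b, True)], []),
      ([(Gen_b, True), (Gen_a, True)], [(Gen_a, False), (Gen_b, True)])}"

definition infinite_dihedral_group :: "dihedral_gen word set monoid" where
  "infinite_dihedral_group = presented_group dihedral_relations"

section \<open>Lateral factor sets\<close>

definition lateral_orbit :: "('a, 'm) monoid_scheme \<Rightarrow> 'a \<Rightarrow> 'a \<Rightarrow> ('a \<times> 'a) set" where
  "lateral_orbit G x y =
     {(x, y),
      (inv\<^bsub>G\<^esub> y \<otimes>\<^bsub>G\<^esub> inv\<^bsub>G\<^esub> x, x),
      (y, inv\<^bsub>G\<^esub> y \<otimes>\<^bsub>G\<^esub> inv\<^bsub>G\<^esub> x),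
      (inv\<^bsub>G\<^esub> y, inv\<^bsub>G\<^esub> x),
      (inv\<^bsub>G\<^esub> x, x \<otimes>\<^bsub>G\<^esub> y),
      (x \<otimes>\<^bsub>G\<^esub> y, inv\<^bsub>G\<^esub> y)}"

text \<open>
  Functions on a carrier set are represented by extensional functions (constantly
  \<^const>\<open>undefined\<close> outside), so that equality of functions means equality on the carrier.
\<close>

definition lateral_sigma ::
  "('k, 'n) ring_scheme \<Rightarrow> ('a, 'm) monoid_scheme \<Rightarrow> ('a \<times> 'a) set \<Rightarrow> 'a \<times> 'a \<Rightarrow> 'k" where
  "lateral_sigma K G W =
     (\<lambda>(x, y) \<in> carrier G \<times> carrier G.
        if lateral_orbit G x y \<inter> W \<noteq> {} then \<zero>\<^bsub>K\<^esub> else \<one>\<^bsub>K\<^esub>)"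

definition lateral_factor_sets ::
  "('k, 'n) ring_scheme \<Rightarrow> ('a, 'm) monoid_scheme \<Rightarrow> ('a \<times> 'a \<Rightarrow> 'k) set" where
  "lateral_factor_sets K G =
     {lateral_sigma K G W | W.
        W \<subseteq> carrier G \<times> carrier G \<and>
        (\<forall>z \<in> carrier G. lateral_orbit G z (inv\<^bsub>G\<^esub> z) \<inter> W = {})}"

section \<open>Semigroups of functions under pointwise multiplication\<close>

text \<open>
  The HOL-Algebra record for a carrier with a multiplication also has a field for a unit; it is
  filled with the constant function \<open>1\<close>, but it plays no role in \<open>is_semigroup\<close> or in
  \<open>\<cong>\<close>, both of which refer to the carrier and the multiplication only.
\<close>

definition pointwise_structure ::
  "('k, 'n) ring_scheme \<Rightarrow> 'p set \<Rightarrow> ('p \<Rightarrow> 'k) set \<Rightarrow> ('p \<Rightarrow> 'k) monoid" where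
  "pointwise_structure K A F =
     \<lparr>carrier = F,
      monoid.mult = (\<lambda>f g. \<lambda>p\<in>A. f p \<otimes>\<^bsub>K\<^esub> g p),
      one = (\<lambda>p\<in>A. \<one>\<^bsub>K\<^esub>)\<rparr>"

definition is_semigroup :: "('a, 'm) monoid_scheme \<Rightarrow> bool" where
  "is_semigroup S \<longleftrightarrow>
     (\<forall>x \<in> carrier S. \<forall>y \<in> carrier S. x \<otimes>\<^bsub>S\<^esub> y \<in> carrier S) \<and>
     (\<forall>x \<in> carrier S. \<forall>y \<in> carrier S. \<forall>z \<in> carrier S.
        (x \<otimes>\<^bsub>S\<^esub> y) \<otimes>\<^bsub>S\<^esub> z = x \<otimes>\<^bsub>S\<^esub> (y \<otimes>\<^bsub>S\<^esub> z))"

definition lateral_semigroup ::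
  "('k, 'n) ring_scheme \<Rightarrow> ('a, 'm) monoid_scheme \<Rightarrow> ('a \<times> 'a \<Rightarrow> 'k) monoid" where
  "lateral_semigroup K G =
     pointwise_structure K (carrier G \<times> carrier G) (lateral_factor_sets K G)"

definition zero_one_semigroup :: "('k, 'n) ring_scheme \<Rightarrow> 'p set \<Rightarrow> ('p \<Rightarrow> 'k) monoid" where
  "zero_one_semigroup K A = pointwise_structure K A (A \<rightarrow>\<^sub>E {\<zero>\<^bsub>K\<^esub>, \<one>\<^bsub>K\<^esub>})"

text \<open>\<open>\<int>\<^sup>+ \<times> \<int>\<^sup>+ \<squnion> \<int>\<^sup>+ \<times> \<int>\<close>\<close>

definition dihedral_index_set :: "(int \<times> int + int \<times> int) set" where
  "dihedral_index_set = ({0<..} \<times> {0<..}) <+> ({0<..} \<times> UNIV)"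

end

theory Submission
  imports Defs "HOL-Library.Countable_Set"
begin

text \<open>
  The sets \<open>C_(x,y)\<close> are the orbits of an action of \<open>S\<^sub>3\<close> on \<open>G \<times> G\<close>, so they partition it, and a
  lateral factor set is the same thing as a \<open>{0,1}\<close>-valued function on the set of those orbits
  that contain no pair \<open>(z, z\<^sup>-\<^sup>1)\<close>.  Up to isomorphism the semigroup therefore depends only on the
  number of these orbits.  They are finite, and \<open>(x, y)\<close> lies in one of them as soon as
  \<open>x\<close>, \<open>y\<close> and \<open>x y\<close> are all different from \<open>1\<close>; hence a countably infinite group has countably
  infinitely many of them, just as many as the index set has elements.  The infinite dihedral
  group is infinite because it acts on \<open>\<int>\<close> by \<open>a n = n + 1\<close> and \<open>b n = - n\<close>.
\<close>

section \<open>Orbits of pairs\<close>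

lemma lateral_orbit_self: "(x, y) \<in> lateral_orbit G x y"
  by (simp add: lateral_orbit_def)

lemma finite_lateral_orbit: "finite (lateral_orbit G x y)"
  by (simp add: lateral_orbit_def)

lemma (in group) lateral_orbit_closed:
  "x \<in> carrier G \<Longrightarrow> y \<in> carrier G \<Longrightarrow> lateral_orbit G x y \<subseteq> carrier G \<times> carrier G"
  by (simp add: lateral_orbit_def)

text \<open>With z = \<open>inv y \<otimes> inv x\<close> the pair stands for a triple of product 1.
  The orbit consists of the first two entries of the three rotations of (x, y, z) and of the three
  rotations of the inverted reversal (z^-1, y^-1, x^-1). These operations form a group, so starting
  from any of the six pairs gives the same set.\<close>

lemma (in group) lateral_orbit_eq:
  assumes [simp]: "x \<in> carrier G" "y \<in> carrier G" and uv: "(u, v) \<in> lateral_orbit G x y"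
  shows "lateral_orbit G u v = lateral_orbit G x y"
proof -
  \<comment> \<open>With products bracketed to the right by \<open>m_assoc\<close>, a factor and its
    inverse meet in this shape.\<close>
  have cancel: "inv p \<otimes> (p \<otimes> q) = q" "p \<otimes> (inv p \<otimes> q) = q"
    if "p \<in> carrier G" "q \<in> carrier G" for p q
    using that by (simp_all add: m_assoc[symmetric])
  show ?thesis
    using uv unfolding lateral_orbit_def
    by (elim insertE emptyE) (auto simp: inv_mult_group m_assoc cancel)
qed

text \<open>These are the pairs whose orbit every admissible \<open>W\<close> must avoid, so that
  the value there is forced to be 1.\<close>

definition trivial_pair :: "('a, 'm) monoid_scheme \<Rightarrow> 'a \<times> 'a \<Rightarrow> bool" where
  "trivial_pair G p \<longleftrightarrow> (\<exists>z\<in>carrier G. p \<in> lateral_orbit G z (inv\<^bsub>G\<^esub> z))"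

text \<open>The orbit of (z, z^-1) collapses to the pairs (z, z^-1), (1, z) and (z^-1, 1).\<close>

lemma (in group) trivial_pairD:
  assumes "trivial_pair G (x, y)"
  shows "x = \<one> \<or> y = \<one> \<or> x \<otimes> y = \<one>"
  using assms by (auto simp: trivial_pair_def lateral_orbit_def)

lemma (in group) trivial_pair_orbit:
  assumes "x \<in> carrier G" "y \<in> carrier G" "(u, v) \<in> lateral_orbit G x y"
  shows "trivial_pair G (u, v) \<longleftrightarrow> trivial_pair G (x, y)"
proof -
  have "lateral_orbit G u v = lateral_orbit G x y" using lateral_orbit_eq assms by blast
  then show ?thesis
    unfolding trivial_pair_def using lateral_orbit_eq assms lateral_orbit_self inv_closed by metis
qed

definition nontrivial_orbits :: "('a, 'm) monoid_scheme \<Rightarrow> ('a \<times> 'a) set set" where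
  "nontrivial_orbits G =
     case_prod (lateral_orbit G) ` {p \<in> carrier G \<times> carrier G. \<not> trivial_pair G p}"

text \<open>A single first coordinate x other than 1 already gives infinitely many nontrivial pairs,
  and finitely many orbits of at most six pairs each cannot cover them.\<close>

lemma (in group) infinite_nontrivial_orbits:
  assumes inf: "infinite (carrier G)"
  shows "infinite (nontrivial_orbits G)"
proof
  assume fin: "finite (nontrivial_orbits G)"
  have "infinite (carrier G - {\<one>})" using inf by simp
  then obtain x where x: "x \<in> carrier G" "x \<noteq> \<one>" by (metis DiffE ex_in_conv finite.emptyI singletonI)
  have "Pair x ` (carrier G - {\<one>, inv x}) \<subseteq> \<Union>(nontrivial_orbits G)"
  proof
    fix p assume "p \<in> Pair x ` (carrier G - {\<one>, inv x})"
    then obtain y where y: "p = (x, y)" "y \<in> carrier G" "y \<noteq> \<one>" "y \<noteq> inv x" by blast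
    then have "\<not> trivial_pair G (x, y)"
      using trivial_pairD x by (metis inv_equality inv_inv)
    then show "p \<in> \<Union>(nontrivial_orbits G)"
      using x y lateral_orbit_self unfolding nontrivial_orbits_def by force
  qed
  moreover have "finite (\<Union>(nontrivial_orbits G))"
    using fin by (auto simp: nontrivial_orbits_def finite_lateral_orbit)
  ultimately have "finite (Pair x ` (carrier G - {\<one>, inv x}))"
    using finite_subset by blast
  then have "finite (carrier G - {\<one>, inv x})"
    by (rule finite_imageD) (simp add: inj_on_def)
  then show False using inf by simp
qed

lemma countable_nontrivial_orbits:
  "countable (carrier G) \<Longrightarrow> countable (nontrivial_orbits G)"
  unfolding nontrivial_orbits_def by (intro countable_image countable_Collect countable_SIGMA)

section \<open>Lateral factor sets as functions on orbits\<close>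

text \<open>This removes the quantifier over \<open>W\<close>: membership becomes a set of
  conditions on values of \<open>f\<close>, which are easy to check for products.\<close>

lemma (in group) lateral_factor_sets_iff:
  assumes "\<zero>\<^bsub>K\<^esub> \<noteq> \<one>\<^bsub>K\<^esub>"
  shows "f \<in> lateral_factor_sets K G \<longleftrightarrow>
    f \<in> carrier G \<times> carrier G \<rightarrow>\<^sub>E {\<zero>\<^bsub>K\<^esub>, \<one>\<^bsub>K\<^esub>} \<and>
    (\<forall>x\<in>carrier G. \<forall>y\<in>carrier G. \<forall>q\<in>lateral_orbit G x y. f q = f (x, y)) \<and>
    (\<forall>p\<in>carrier G \<times> carrier G. trivial_pair G p \<longrightarrow> f p = \<one>\<^bsub>K\<^esub>)"
    (is "_ \<longleftrightarrow> ?funcs \<and> ?const \<and> ?triv")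
proof
  assume "f \<in> lateral_factor_sets K G"
  then obtain W where f: "f = lateral_sigma K G W"
    and W: "\<And>z. z \<in> carrier G \<Longrightarrow> lateral_orbit G z (inv z) \<inter> W = {}"
    unfolding lateral_factor_sets_def by blast
  have ?funcs unfolding f lateral_sigma_def by (auto split: if_splits)
  moreover have ?const
  proof (intro ballI)
    fix x y q assume xy: "x \<in> carrier G" "y \<in> carrier G" and q: "q \<in> lateral_orbit G x y"
    moreover obtain u v where "q = (u, v)" by (cases q)
    ultimately show "f q = f (x, y)"
      using lateral_orbit_closed[OF xy] lateral_orbit_eq[OF xy, of u v]
      by (auto simp: f lateral_sigma_def)
  qed
  moreover have ?triv
  proof (intro ballI impI)
    fix p assume p: "p \<in> carrier G \<times> carrier G" "trivial_pair G p"
    then obtain z where z: "z \<in> carrier G" "p \<in> lateral_orbit G z (inv z)"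
      unfolding trivial_pair_def by blast
    obtain u v where uv: "p = (u, v)" by (cases p)
    then have "lateral_orbit G u v \<inter> W = {}"
      using W z lateral_orbit_eq by (metis inv_closed)
    then show "f p = \<one>\<^bsub>K\<^esub>" using p uv by (simp add: f lateral_sigma_def)
  qed
  ultimately show "?funcs \<and> ?const \<and> ?triv" by blast
next
  assume "?funcs \<and> ?const \<and> ?triv"
  then have funcs: ?funcs and const: ?const and triv: ?triv by (iprover dest: conjunct1 conjunct2)+
  \<comment> \<open>The zero set of \<open>f\<close> is a union of orbits, so an orbit meets it
    exactly when \<open>f\<close> vanishes on that orbit. It avoids the trivial pairs because 1
    differs from 0.\<close>
  define W where "W = {p \<in> carrier G \<times> carrier G. f p = \<zero>\<^bsub>K\<^esub>}"
  have "f = lateral_sigma K G W"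
  proof (rule extensionalityI[where A = "carrier G \<times> carrier G"])
    show "f \<in> extensional (carrier G \<times> carrier G)" using funcs by (simp add: PiE_def)
    show "lateral_sigma K G W \<in> extensional (carrier G \<times> carrier G)"
      by (simp add: lateral_sigma_def)
    fix p assume "p \<in> carrier G \<times> carrier G"
    then obtain x y where p: "p = (x, y)" "x \<in> carrier G" "y \<in> carrier G" by blast
    have "lateral_orbit G x y \<inter> W \<noteq> {} \<longleftrightarrow> f (x, y) = \<zero>\<^bsub>K\<^esub>"
    proof
      assume "lateral_orbit G x y \<inter> W \<noteq> {}"
      then obtain q where "q \<in> lateral_orbit G x y" "f q = \<zero>\<^bsub>K\<^esub>" unfolding W_def by blast
      then show "f (x, y) = \<zero>\<^bsub>K\<^esub>" using const p(2,3) by metis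
    next
      assume "f (x, y) = \<zero>\<^bsub>K\<^esub>"
      then have "(x, y) \<in> W" using p by (simp add: W_def)
      then show "lateral_orbit G x y \<inter> W \<noteq> {}" using lateral_orbit_self[of x y G] by blast
    qed
    moreover have "f (x, y) \<in> {\<zero>\<^bsub>K\<^esub>, \<one>\<^bsub>K\<^esub>}" by (rule PiE_mem[OF funcs]) (simp add: p)
    ultimately show "f p = lateral_sigma K G W p"
      using p by (auto simp: lateral_sigma_def)
  qed
  moreover have "lateral_orbit G z (inv z) \<inter> W = {}" if "z \<in> carrier G" for z
  proof -
    have "p \<notin> W" if "p \<in> lateral_orbit G z (inv z)" for p
    proof
      assume "p \<in> W"
      then have "p \<in> carrier G \<times> carrier G" "f p = \<zero>\<^bsub>K\<^esub>" by (simp_all add: W_def)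
      moreover have "trivial_pair G p" using \<open>z \<in> carrier G\<close> that unfolding trivial_pair_def by blast
      ultimately show False using triv assms by simp
    qed
    then show ?thesis by blast
  qed
  moreover have "W \<subseteq> carrier G \<times> carrier G" unfolding W_def by blast
  ultimately show "f \<in> lateral_factor_sets K G" unfolding lateral_factor_sets_def by blast
qed

lemma (in group) lateral_factor_setsD:
  assumes "\<zero>\<^bsub>K\<^esub> \<noteq> \<one>\<^bsub>K\<^esub>" "f \<in> lateral_factor_sets K G"
  shows "f \<in> carrier G \<times> carrier G \<rightarrow>\<^sub>E {\<zero>\<^bsub>K\<^esub>, \<one>\<^bsub>K\<^esub>}"
    and "x \<in> carrier G \<Longrightarrow> y \<in> carrier G \<Longrightarrow> q \<in> lateral_orbit G x y \<Longrightarrow> f q = f (x, y)"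
    and "p \<in> carrier G \<times> carrier G \<Longrightarrow> trivial_pair G p \<Longrightarrow> f p = \<one>\<^bsub>K\<^esub>"
proof -
  note D = assms(2)[unfolded lateral_factor_sets_iff[OF assms(1)]]
  show "f \<in> carrier G \<times> carrier G \<rightarrow>\<^sub>E {\<zero>\<^bsub>K\<^esub>, \<one>\<^bsub>K\<^esub>}" using D by (rule conjunct1)
  show "x \<in> carrier G \<Longrightarrow> y \<in> carrier G \<Longrightarrow> q \<in> lateral_orbit G x y \<Longrightarrow> f q = f (x, y)"
    using D[THEN conjunct2, THEN conjunct1] by blast
  show "p \<in> carrier G \<times> carrier G \<Longrightarrow> trivial_pair G p \<Longrightarrow> f p = \<one>\<^bsub>K\<^esub>"
    using D[THEN conjunct2, THEN conjunct2] by blast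
qed

lemma is_semigroup_pointwise_structure:
  assumes "monoid K" "F \<subseteq> A \<rightarrow> carrier K"
    and "\<And>f g. f \<in> F \<Longrightarrow> g \<in> F \<Longrightarrow> (\<lambda>p\<in>A. f p \<otimes>\<^bsub>K\<^esub> g p) \<in> F"
  shows "is_semigroup (pointwise_structure K A F)"
proof -
  have "(\<lambda>p\<in>A. (\<lambda>p\<in>A. f p \<otimes>\<^bsub>K\<^esub> g p) p \<otimes>\<^bsub>K\<^esub> h p) = (\<lambda>p\<in>A. f p \<otimes>\<^bsub>K\<^esub> (\<lambda>p\<in>A. g p \<otimes>\<^bsub>K\<^esub> h p) p)"
    if "f \<in> F" "g \<in> F" "h \<in> F" for f g h
  proof (rule restrict_ext)
    fix p assume p: "p \<in> A"
    then have "f p \<in> carrier K" "g p \<in> carrier K" "h p \<in> carrier K" using that assms(2) by blast+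
    then show "(\<lambda>p\<in>A. f p \<otimes>\<^bsub>K\<^esub> g p) p \<otimes>\<^bsub>K\<^esub> h p = f p \<otimes>\<^bsub>K\<^esub> (\<lambda>p\<in>A. g p \<otimes>\<^bsub>K\<^esub> h p) p"
      using p by (simp add: monoid.m_assoc[OF assms(1)])
  qed
  then show ?thesis
    unfolding is_semigroup_def pointwise_structure_def using assms(3) by simp
qed

lemma (in ring) zero_one_pointwise_mult:
  assumes "f \<in> A \<rightarrow>\<^sub>E {\<zero>, \<one>}" "g \<in> A \<rightarrow>\<^sub>E {\<zero>, \<one>}"
  shows "(\<lambda>p\<in>A. f p \<otimes> g p) \<in> A \<rightarrow>\<^sub>E {\<zero>, \<one>}"
proof -
  have "f p \<otimes> g p \<in> {\<zero>, \<one>}" if "p \<in> A" for p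
    using PiE_mem[OF assms(1) that] PiE_mem[OF assms(2) that] by auto
  then show ?thesis by (simp only: restrict_PiE_iff Ball_def) blast
qed

lemma (in ring) is_semigroup_zero_one: "is_semigroup (zero_one_semigroup R A)"
  unfolding zero_one_semigroup_def
proof (rule is_semigroup_pointwise_structure[OF is_monoid _ zero_one_pointwise_mult])
  show "A \<rightarrow>\<^sub>E {\<zero>, \<one>} \<subseteq> A \<rightarrow> carrier R" by (fastforce simp: PiE_def Pi_def)
qed

text \<open>The product of the functions given by two sets \<open>W\<close> is the one given by
  their union. The proof does not form this union but checks the conditions of
  \<open>lateral_factor_sets_iff\<close> on the product.\<close>

lemma (in group) is_semigroup_lateral:
  assumes "ring K" "\<zero>\<^bsub>K\<^esub> \<noteq> \<one>\<^bsub>K\<^esub>"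
  shows "is_semigroup (lateral_semigroup K G)"
  unfolding lateral_semigroup_def
proof (rule is_semigroup_pointwise_structure)
  interpret K: ring K by fact
  show "monoid K" by (rule K.is_monoid)
  show "lateral_factor_sets K G \<subseteq> carrier G \<times> carrier G \<rightarrow> carrier K"
  proof (intro subsetI Pi_I)
    fix f p assume "f \<in> lateral_factor_sets K G" and p: "p \<in> carrier G \<times> carrier G"
    from lateral_factor_setsD(1)[OF assms(2) this(1)] p have "f p \<in> {\<zero>\<^bsub>K\<^esub>, \<one>\<^bsub>K\<^esub>}"
      by (rule PiE_mem)
    then show "f p \<in> carrier K" by auto
  qed
  fix f g assume fg: "f \<in> lateral_factor_sets K G" "g \<in> lateral_factor_sets K G"
  let ?h = "\<lambda>p\<in>carrier G \<times> carrier G. f p \<otimes>\<^bsub>K\<^esub> g p"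
  have "?h \<in> carrier G \<times> carrier G \<rightarrow>\<^sub>E {\<zero>\<^bsub>K\<^esub>, \<one>\<^bsub>K\<^esub>}"
    by (rule K.zero_one_pointwise_mult[OF fg[THEN lateral_factor_setsD(1)[OF assms(2)]]])
  moreover have "?h q = ?h (x, y)"
    if xy: "x \<in> carrier G" "y \<in> carrier G" and q: "q \<in> lateral_orbit G x y" for x y q
  proof -
    have "q \<in> carrier G \<times> carrier G" using lateral_orbit_closed xy q by blast
    then show ?thesis
      using lateral_factor_setsD(2)[OF assms(2) fg(1) xy q]
        lateral_factor_setsD(2)[OF assms(2) fg(2) xy q] xy
      by simp
  qed
  moreover have "?h p = \<one>\<^bsub>K\<^esub>" if "p \<in> carrier G \<times> carrier G" "trivial_pair G p" for p
    using lateral_factor_setsD(3)[OF assms(2) fg(1) that]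
      lateral_factor_setsD(3)[OF assms(2) fg(2) that] that(1)
    by simp
  ultimately show "?h \<in> lateral_factor_sets K G"
    unfolding lateral_factor_sets_iff[OF assms(2)] by blast
qed

text \<open>The isomorphism evaluates a lateral factor set at a chosen representative
  \<open>r i\<close> of each orbit \<open>e i\<close>. It is injective because these values and the
  forced value 1 on trivial pairs determine everything, and surjective because \<open>W\<close> may
  be any union of nontrivial orbits.\<close>

lemma (in group) lateral_semigroup_iso:
  assumes nz: "\<zero>\<^bsub>K\<^esub> \<noteq> \<one>\<^bsub>K\<^esub>" and e: "bij_betw e I (nontrivial_orbits G)"
  shows "lateral_semigroup K G \<cong> zero_one_semigroup K I"
proof -
  let ?C = "carrier G \<times> carrier G"
  have "\<exists>p. p \<in> ?C \<and> \<not> trivial_pair G p \<and> e i = case_prod (lateral_orbit G) p" if "i \<in> I" for i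
  proof -
    have "e i \<in> nontrivial_orbits G" using bij_betwE[OF e] that by blast
    then show ?thesis unfolding nontrivial_orbits_def image_iff Bex_def mem_Collect_eq by simp
  qed
  then obtain r where r: "\<And>i. i \<in> I \<Longrightarrow> r i \<in> ?C"
      "\<And>i. i \<in> I \<Longrightarrow> \<not> trivial_pair G (r i)"
      "\<And>i. i \<in> I \<Longrightarrow> e i = case_prod (lateral_orbit G) (r i)"
    by metis
  have r_cover: "\<exists>i\<in>I. p \<in> e i" if "p \<in> ?C" "\<not> trivial_pair G p" for p
  proof -
    have "case_prod (lateral_orbit G) p \<in> e ` I"
      unfolding bij_betw_imp_surj_on[OF e] nontrivial_orbits_def
      by (rule imageI) (use that in simp)
    then obtain i where "i \<in> I" "case_prod (lateral_orbit G) p = e i" by blast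
    moreover have "p \<in> case_prod (lateral_orbit G) p"
      by (cases p) (simp add: lateral_orbit_self)
    ultimately show ?thesis by metis
  qed
  have const: "f p = f (r i)" if "f \<in> lateral_factor_sets K G" "i \<in> I" "p \<in> e i" for f i p
    using that r(1)[of i] r(3)[of i]
    by (cases "r i") (simp add: lateral_factor_setsD(2)[OF nz])
  let ?h = "\<lambda>f. \<lambda>i\<in>I. f (r i)"
  have maps: "?h f \<in> I \<rightarrow>\<^sub>E {\<zero>\<^bsub>K\<^esub>, \<one>\<^bsub>K\<^esub>}" if "f \<in> lateral_factor_sets K G" for f
  proof -
    have "f (r i) \<in> {\<zero>\<^bsub>K\<^esub>, \<one>\<^bsub>K\<^esub>}" if "i \<in> I" for i
      using lateral_factor_setsD(1)[OF nz \<open>f \<in> _\<close>] r(1)[OF that] by (rule PiE_mem)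
    then show ?thesis by (simp only: restrict_PiE_iff Ball_def) blast
  qed
  have inj: "inj_on ?h (lateral_factor_sets K G)"
  proof (rule inj_onI)
    fix f g assume f: "f \<in> lateral_factor_sets K G" and g: "g \<in> lateral_factor_sets K G"
      and eq: "?h f = ?h g"
    show "f = g"
    proof (rule extensionalityI[where A = ?C])
      show "f \<in> extensional ?C" "g \<in> extensional ?C"
        using lateral_factor_setsD(1)[OF nz f] lateral_factor_setsD(1)[OF nz g]
        by (simp_all only: PiE_def Int_iff)
      fix p assume p: "p \<in> ?C"
      show "f p = g p"
      proof (cases "trivial_pair G p")
        case True
        then show ?thesis
          using lateral_factor_setsD(3)[OF nz f p] lateral_factor_setsD(3)[OF nz g p] by simp
      next
        case False
        then obtain i where i: "i \<in> I" "p \<in> e i" using r_cover p by blast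
        moreover have "f (r i) = g (r i)" using fun_cong[OF eq, of i] i by simp
        ultimately show ?thesis using const[OF f i] const[OF g i] by simp
      qed
    qed
  qed
  have surj: "w \<in> ?h ` lateral_factor_sets K G" if w: "w \<in> I \<rightarrow>\<^sub>E {\<zero>\<^bsub>K\<^esub>, \<one>\<^bsub>K\<^esub>}" for w
  proof -
    \<comment> \<open>The union of the orbits on which \<open>w\<close> prescribes the value
      0.\<close>
    define W where "W = (\<Union>i\<in>{i\<in>I. w i = \<zero>\<^bsub>K\<^esub>}. e i)"
    \<comment> \<open>What \<open>r\<close> gives for one representative passes to every pair of its
      orbit. In particular, two orbits with a common pair are equal, and injectivity of
      \<open>e\<close> then identifies their indices.\<close>
    have e_props: "p \<in> ?C \<and> \<not> trivial_pair G p \<and> case_prod (lateral_orbit G) p = e i"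
      if "i \<in> I" "p \<in> e i" for i p
    proof -
      obtain x y u v where "r i = (x, y)" "p = (u, v)" by fastforce
      moreover from this have xy: "x \<in> carrier G" "y \<in> carrier G"
        and e: "e i = lateral_orbit G x y" and "\<not> trivial_pair G (x, y)"
        using r[OF that(1)] by simp_all
      moreover have "(u, v) \<in> lateral_orbit G x y" using that e \<open>p = (u, v)\<close> by simp
      ultimately show ?thesis
        using lateral_orbit_closed[OF xy] trivial_pair_orbit[OF xy] lateral_orbit_eq[OF xy] by auto
    qed
    have "W \<subseteq> ?C" using e_props unfolding W_def by blast
    moreover have "lateral_orbit G z (inv z) \<inter> W = {}" if "z \<in> carrier G" for z
      using e_props that unfolding W_def trivial_pair_def by blast
    ultimately have "lateral_sigma K G W \<in> lateral_factor_sets K G"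
      unfolding lateral_factor_sets_def by blast
    moreover have "w = ?h (lateral_sigma K G W)"
    proof (rule extensionalityI[where A = I])
      show "w \<in> extensional I" using w by (simp add: PiE_def)
      fix i assume i: "i \<in> I"
      have "e i \<inter> W \<noteq> {} \<longleftrightarrow> w i = \<zero>\<^bsub>K\<^esub>"
      proof
        assume "e i \<inter> W \<noteq> {}"
        then obtain p j where "p \<in> e i" "p \<in> e j" "j \<in> I" "w j = \<zero>\<^bsub>K\<^esub>" unfolding W_def by blast
        moreover from this have "e i = e j" using e_props[of i p] e_props[of j p] i by simp
        ultimately have "i = j" using inj_onD[OF bij_betw_imp_inj_on[OF e]] i by blast
        with \<open>w j = \<zero>\<^bsub>K\<^esub>\<close> show "w i = \<zero>\<^bsub>K\<^esub>" by simp
      next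
        have "r i \<in> e i" using r(3)[OF i] lateral_orbit_self by (cases "r i") auto
        moreover assume "w i = \<zero>\<^bsub>K\<^esub>"
        ultimately show "e i \<inter> W \<noteq> {}" using i unfolding W_def by blast
      qed
      moreover have "w i \<in> {\<zero>\<^bsub>K\<^esub>, \<one>\<^bsub>K\<^esub>}" using w i by (rule PiE_mem)
      ultimately show "w i = ?h (lateral_sigma K G W) i"
        using i r(1)[OF i] r(3)[OF i] by (auto simp: lateral_sigma_def split: prod.splits)
    qed simp
    ultimately show ?thesis by blast
  qed
  have "?h \<in> hom (lateral_semigroup K G) (zero_one_semigroup K I)"
  proof (rule homI)
    fix f g
    show "?h f \<in> carrier (zero_one_semigroup K I)" if "f \<in> carrier (lateral_semigroup K G)"
      using maps that by (simp only: zero_one_semigroup_def lateral_semigroup_def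
          pointwise_structure_def partial_object.simps)
    \<comment> \<open>Each \<open>r i\<close> lies in \<open>?C\<close>, so the restricted product
      is evaluated where it is the actual product and not \<open>undefined\<close>.\<close>
    have "?h (\<lambda>p\<in>?C. f p \<otimes>\<^bsub>K\<^esub> g p) = (\<lambda>i\<in>I. ?h f i \<otimes>\<^bsub>K\<^esub> ?h g i)"
      by (rule restrict_ext) (use r(1) in simp)
    then show "?h (f \<otimes>\<^bsub>lateral_semigroup K G\<^esub> g) = ?h f \<otimes>\<^bsub>zero_one_semigroup K I\<^esub> ?h g"
      by (simp only: zero_one_semigroup_def lateral_semigroup_def
          pointwise_structure_def monoid.simps)
  qed
  moreover have "bij_betw ?h (carrier (lateral_semigroup K G)) (carrier (zero_one_semigroup K I))"
    unfolding lateral_semigroup_def zero_one_semigroup_def pointwise_structure_def partial_object.simps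
    using inj maps surj by (intro bij_betw_imageI) blast+
  ultimately show ?thesis unfolding is_iso_def iso_def by blast
qed

section \<open>The infinite dihedral group is countably infinite\<close>

text \<open>The reflection is its own inverse, so \<open>Gen_b\<close> and its formal inverse act
  alike.\<close>

fun letter_act :: "dihedral_gen \<times> bool \<Rightarrow> int \<Rightarrow> int" where
  "letter_act (Gen_a, True) n = n + 1"
| "letter_act (Gen_a, False) n = n - 1"
| "letter_act (Gen_b, _) n = - n"

text \<open>Folding from the right lets the last letter act first, so concatenation of words becomes
  composition of maps.\<close>

definition word_act :: "dihedral_gen word \<Rightarrow> int \<Rightarrow> int" where
  "word_act = foldr letter_act"

text \<open>The action respects the defining relations: the reflection squares to the identity, and
  -(n + 1) = -n - 1 is the relation b a = a^-1 b. Hence it can tell group elements apart.\<close>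

lemma word_act_cong: "word_eq dihedral_relations u v \<Longrightarrow> word_act u = word_act v"
proof (induction rule: word_eq.induct)
  case (cancel x e)
  show ?case by (cases x; cases e) (auto simp: word_act_def)
qed (auto simp: word_act_def dihedral_relations_def fun_eq_iff)

lemma word_act_replicate: "word_act (replicate k (Gen_a, True)) 0 = int k"
  by (induction k) (auto simp: word_act_def)

text \<open>The powers of a are pairwise distinct because they send 0 to different integers.\<close>

lemma infinite_infinite_dihedral_group: "infinite (carrier infinite_dihedral_group)"
proof -
  have "inj (\<lambda>k. word_class dihedral_relations (replicate k (Gen_a, True)))"
    by (rule injI) (metis word_class_eq_iff word_act_cong word_act_replicate of_nat_eq_iff)
  then have "infinite (range (\<lambda>k. word_class dihedral_relations (replicate k (Gen_a, True))))"
    by (rule range_inj_infinite)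
  moreover have "range (\<lambda>k. word_class dihedral_relations (replicate k (Gen_a, True)))
      \<subseteq> carrier infinite_dihedral_group"
    by (auto simp: infinite_dihedral_group_def presented_group_def)
  ultimately show ?thesis using infinite_super by blast
qed

text \<open>This makes the type of words countable, and the carrier is the range of a function on
  words.\<close>

instance dihedral_gen :: countable
  by countable_datatype

lemma countable_infinite_dihedral_group: "countable (carrier infinite_dihedral_group)"
  by (simp add: infinite_dihedral_group_def presented_group_def)

lemma infinite_dihedral_index_set: "infinite dihedral_index_set"
proof -
  have "infinite ({0<..} \<times> {0<..} :: (int \<times> int) set)"
    by (simp add: finite_cartesian_product_iff infinite_Ioi)
  then show ?thesis by (simp add: dihedral_index_set_def finite_Plus_iff)
qed

theorem proposition10p6:
  fixes K :: "('k, 'n) ring_scheme"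
  assumes "field K"
  shows "is_semigroup (lateral_semigroup K infinite_dihedral_group) \<and>
         is_semigroup (zero_one_semigroup K dihedral_index_set) \<and>
         lateral_semigroup K infinite_dihedral_group \<cong> zero_one_semigroup K dihedral_index_set"
proof -
  interpret K: field K by fact
  interpret D: group infinite_dihedral_group
    unfolding infinite_dihedral_group_def by (rule group_presented_group)
  let ?Q = "nontrivial_orbits infinite_dihedral_group"
  \<comment> \<open>No explicit list of orbit representatives is computed: the index set and the set
    of orbits are matched through the natural numbers.\<close>
  have "bij_betw (to_nat_on dihedral_index_set) dihedral_index_set UNIV"
    by (intro to_nat_on_infinite countableI_type infinite_dihedral_index_set)
  moreover have "bij_betw (from_nat_into ?Q) UNIV ?Q"
    by (intro bij_betw_from_nat_into countable_nontrivial_orbits D.infinite_nontrivial_orbits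
        countable_infinite_dihedral_group infinite_infinite_dihedral_group)
  ultimately have "bij_betw (from_nat_into ?Q \<circ> to_nat_on dihedral_index_set) dihedral_index_set ?Q"
    by (rule bij_betw_trans)
  then have "lateral_semigroup K infinite_dihedral_group \<cong> zero_one_semigroup K dihedral_index_set"
    by (rule D.lateral_semigroup_iso[OF K.one_not_zero[symmetric]])
  then show ?thesis
    using D.is_semigroup_lateral[OF K.ring_axioms K.one_not_zero[symmetric]]
      K.is_semigroup_zero_one by blast
qed

end
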